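(* Let $F=\frac1n\sum_{i=1}^nF_i$ with each $F_i:\mathbb{R}^d\to\mathbb{R}^d$ $L$-Lipschitz, and suppose there exists an interpolating solution $x_*$, for which $F_i(x_* )=0$ for all $i\in\{1,\dots,n\}$. Suppose the step sizes $\gamma_k$ of PolyakSEG satisfy, for all $k$, the critical condition with respect to $F_{\mathcal S_k}$ with $0<A<1$: $$\|F_{\mathcal S_k}(\hat x_k)-F_{\mathcal S_k}(x_k)\|\le A\|F_{\mathcal S_k}(x_k)\|\qquad\text{for }\hat x_k=x_k-\gamma_kF_{\mathcal S_k}(x_k).$$ Then PolyakSEG satisfies: (1) When the $F_i$ are monotone, $$\min_{0\le k\le K}\mathbb{E}\left[\gamma_k^2\|F(x_k)\|^2\right]\le\frac{(1+A)\|x_0-x_*\|^2}{(1-A)(K+1)}.$$ (2) When the $F_i$ are $\mu$-strongly monotone, $$\mathbb{E}\left[\|x_{k+1}-x_*\|^2\right]\le\mathbb{E}\left[\left(1-\frac{2(1-A)\gamma_k\mu}{(1+A)^2}\right)\|x_k-x_*\|^2\right].$$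
   Context: For a minibatch $\mathcal S\subseteq\{1,\dots,n\}$ of size $B$, $F_{\mathcal S}(x):=\frac1B\sum_{i\in\mathcal S}F_i(x)$; the $\mathcal S_k$ are random subsets of size $B$ sampled independently at each iteration $k$, and $F_{\mathcal S_k}(x)$ is an unbiased estimator of $F(x)$. PolyakSEG: given an initial point $x_0\in\mathbb{R}^d$ and a positive sequence $\{\gamma_k\}_{k\ge0}$, for $k=0,1,\dots,K$: sample $\mathcal S_k$ and set $$\hat x_k=x_k-\gamma_kF_{\mathcal S_k}(x_k),\quad\omega_k=\frac{\langle F_{\mathcal S_k}(\hat x_k),x_k-\hat x_k\rangle}{\|F_{\mathcal S_k}(\hat x_k)\|^2},\quad x_{k+1}=x_k-\omega_kF_{\mathcal S_k}(\hat x_k).$$ The critical condition is meant to cover both constant step sizes and step sizes $\gamma_k$ selected by line search. Monotone: $\langle F_i(x)-F_i(y),x-y\rangle\ge0$ for all $x,y\in\mathbb{R}^d$. $\mu$-strongly monotone ($\mu>0$): $\langle F_i(x)-F_i(y),x-y\rangle\ge\mu\|x-y\|^2$ for all $x,y\in\mathbb{R}^d$.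
   Formalization: Part (1) additionally assumes each minibatch S_k is independent of the earlier minibatches and of the step sizes γ_0,…,γ_k; the bound is false if γ_k may depend on S_k (e.g. line search on F_{S_k}). Part (2) needs no such assumption. *)

theory Defs
  imports "HOL-Analysis.Analysis" "HOL-Probability.Probability"
begin

definition minibatch_op ::
    "(nat \<Rightarrow> real ^ 'd \<Rightarrow> real ^ 'd) \<Rightarrow> nat \<Rightarrow> nat set \<Rightarrow> real ^ 'd \<Rightarrow> real ^ 'd"
  where "minibatch_op F B S x = (1 / real B) *\<^sub>R (\<Sum>i\<in>S. F i x)"

definition full_op :: "(nat \<Rightarrow> real ^ 'd \<Rightarrow> real ^ 'd) \<Rightarrow> nat \<Rightarrow> real ^ 'd \<Rightarrow> real ^ 'd"
  where "full_op F n x = (1 / real n) *\<^sub>R (\<Sum>i = 1..n. F i x)"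

definition monotone_operator :: "(real ^ 'd \<Rightarrow> real ^ 'd) \<Rightarrow> bool"
  where "monotone_operator G \<longleftrightarrow> (\<forall>x y. (G x - G y) \<bullet> (x - y) \<ge> 0)"

definition strongly_monotone_operator :: "real \<Rightarrow> (real ^ 'd \<Rightarrow> real ^ 'd) \<Rightarrow> bool"
  where "strongly_monotone_operator \<mu> G \<longleftrightarrow>
    (\<forall>x y. (G x - G y) \<bullet> (x - y) \<ge> \<mu> * (norm (x - y))\<^sup>2)"

definition extrapolate :: "(real ^ 'd \<Rightarrow> real ^ 'd) \<Rightarrow> real \<Rightarrow> real ^ 'd \<Rightarrow> real ^ 'd"
  where "extrapolate G \<gamma> x = x - \<gamma> *\<^sub>R G x"

(* If G vanishes at the extrapolated point, the quotient is 0 / 0, which is 0 in HOL.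
   The update then leaves x unchanged whatever value the quotient is given.  Under the
   critical condition with A < 1 this happens only if G x = 0. *)
definition polyak_step :: "(real ^ 'd \<Rightarrow> real ^ 'd) \<Rightarrow> real \<Rightarrow> real ^ 'd \<Rightarrow> real"
  where "polyak_step G \<gamma> x =
    (G (extrapolate G \<gamma> x) \<bullet> (x - extrapolate G \<gamma> x)) / (norm (G (extrapolate G \<gamma> x)))\<^sup>2"

(* The iterates for one realisation s of the minibatches and g of the step sizes. *)
primrec polyak_seg ::
    "(nat \<Rightarrow> real ^ 'd \<Rightarrow> real ^ 'd) \<Rightarrow> nat \<Rightarrow> (nat \<Rightarrow> nat set) \<Rightarrow> (nat \<Rightarrow> real) \<Rightarrow> real ^ 'd
      \<Rightarrow> nat \<Rightarrow> real ^ 'd"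
  where
    "polyak_seg F B s g x0 0 = x0"
  | "polyak_seg F B s g x0 (Suc k) =
      (let x = polyak_seg F B s g x0 k; G = minibatch_op F B (s k)
       in x - polyak_step G (g k) x *\<^sub>R G (extrapolate G (g k) x))"

definition critical_condition ::
    "real \<Rightarrow> (real ^ 'd \<Rightarrow> real ^ 'd) \<Rightarrow> real \<Rightarrow> real ^ 'd \<Rightarrow> bool"
  where "critical_condition A G \<gamma> x \<longleftrightarrow>
    norm (G (extrapolate G \<gamma> x) - G x) \<le> A * norm (G x)"

(* The events determined by S_0, ..., S_(k-1) and gamma_0, ..., gamma_k.  The iterate x_k is
   measurable with respect to this sigma-algebra. *)
definition history ::
    "'w measure \<Rightarrow> (nat \<Rightarrow> 'w \<Rightarrow> nat set) \<Rightarrow> (nat \<Rightarrow> 'w \<Rightarrow> real) \<Rightarrow> nat \<Rightarrow> 'w set set"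
  where "history M S \<gamma> k = sigma_sets (space M)
    ((\<Union>j\<in>{..<k}. sets (vimage_algebra (space M) (S j) (count_space UNIV))) \<union>
     (\<Union>j\<in>{..k}. sets (vimage_algebra (space M) (\<gamma> j) borel)))"

(* The minibatch S_k is drawn independently of everything fixed before it, gamma_k included.
   For independent minibatches this holds if every gamma_k is a constant or a measurable
   function of S_0, ..., S_(k-1).  It excludes gamma_k that depend on S_k, for which the bound
   on E[gamma_k^2 |F(x_k)|^2] is false: for F_1 x = eps * x, F_2 x = x on the real line, B = 1,
   uniform sampling, and gamma_0 equal to A / eps or A according to whether S_0 is {1} or {2},
   the critical condition holds, yet E[gamma_0^2 |F(x_0)|^2] is at least
   A^2 |x_0|^2 / (8 eps^2). *)
definition sampled_after_step_size ::
    "'w measure \<Rightarrow> (nat \<Rightarrow> 'w \<Rightarrow> nat set) \<Rightarrow> (nat \<Rightarrow> 'w \<Rightarrow> real) \<Rightarrow> bool"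
  where "sampled_after_step_size M S \<gamma> \<longleftrightarrow>
    (\<forall>k. prob_space.indep_set M (history M S \<gamma> k)
           (sets (vimage_algebra (space M) (S k) (count_space UNIV))))"

end

theory Submission
  imports Defs
begin

text \<open>
  The analysis of a single step is deterministic.  Fix a minibatch with operator \<open>G\<close>, let \<open>y\<close> be the
  point extrapolated from \<open>x\<close> with step size \<open>\<gamma>\<close>, and let \<open>z\<close> be a zero of \<open>G\<close>; by interpolation, the
  solution is a zero of every minibatch operator.  The Polyak step projects \<open>x\<close> onto the hyperplane
  through \<open>y\<close> orthogonal to \<open>G y\<close>, which separates \<open>x\<close> from \<open>z\<close> when \<open>G\<close> is monotone.  The squared
  distance to \<open>z\<close> therefore drops by at least the squared length \<open>\<gamma>\<^sup>2 (G x \<bullet> G y)\<^sup>2 / |G y|\<^sup>2\<close> of the step, plus a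
  multiple of \<open>\<mu> |y - z|\<^sup>2\<close> if \<open>G\<close> is \<open>\<mu>\<close>-strongly monotone.  The critical condition keeps the angle
  between \<open>G x\<close> and \<open>G y\<close> small, its squared cosine being at least \<open>1 - A\<^sup>2\<close>, so the drop is at least
  \<open>(1 - A\<^sup>2) \<gamma>\<^sup>2 |G x|\<^sup>2\<close>.  This is \<open>polyak_update_descent\<close>.

  In the strongly monotone case the two gains together dominate a fraction of \<open>|x - z|\<^sup>2\<close>
  (\<open>polyak_update_contraction\<close>).  The resulting contraction holds for every realisation, so taking
  expectations gives the linear rate.  The integrals exist because the distance to the
  solution never exceeds its initial value.

  In the monotone case, summing the drops telescopes and bounds the sum over \<open>k\<close> of the expectations of
  \<open>\<gamma>\<^sub>k\<^sup>2 |G\<^sub>k x\<^sub>k|\<^sup>2\<close>, where \<open>G\<^sub>k\<close> is the minibatch operator.  The full operator \<open>F\<close> enters through Jensen's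
  inequality: \<open>|F y|\<^sup>2 \<le> E |G\<^sub>k y|\<^sup>2\<close> for a fixed point \<open>y\<close> (\<open>norm_expectation_square_le\<close>).  Inserting
  the random point \<open>x\<^sub>k\<close> and the factor \<open>\<gamma>\<^sub>k\<^sup>2\<close> requires that the minibatch be independent of both, so
  that it can be averaged first (\<open>nn_integral_decouple\<close>).  The minimum over \<open>k\<close> is at most the average.
\<close>

section \<open>One step of the method\<close>

text \<open>
  Squaring the relative error bound gives \<open>2 (a \<bullet> b) \<ge> |b|\<^sup>2 + (1 - A\<^sup>2) |a|\<^sup>2\<close>.  By the
  arithmetic-geometric mean inequality, the right-hand side is at least \<open>2 sqrt (1 - A\<^sup>2) |a| |b|\<close>,
  which bounds the cosine of the angle between \<open>a\<close> and \<open>b\<close> from below.  Inserting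
  \<open>|b| \<le> (1 + A) |a|\<close> instead gives the second bound.  For \<open>a = G x\<close> and
  \<open>b = G (extrapolate G \<gamma> x) \<noteq> 0\<close> it says that the Polyak step is at least \<open>\<gamma> / (1 + A)\<close>.
\<close>
lemma
  fixes a b :: "'a :: real_inner"
  assumes A: "0 \<le> A" "A < 1" and close: "norm (b - a) \<le> A * norm a"
  shows relative_error_inner_square: "(1 - A\<^sup>2) * (norm a)\<^sup>2 * (norm b)\<^sup>2 \<le> (a \<bullet> b)\<^sup>2"
    and relative_error_inner_lower: "(norm b)\<^sup>2 \<le> (1 + A) * (a \<bullet> b)"
proof -
  have A2: "A\<^sup>2 \<le> 1"
    using A by (simp add: power_le_one)
  have "(norm (b - a))\<^sup>2 \<le> (A * norm a)\<^sup>2"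
    using close by (simp add: power_mono)
  then have base: "(norm b)\<^sup>2 + (1 - A\<^sup>2) * (norm a)\<^sup>2 \<le> 2 * (a \<bullet> b)"
    by (simp add: power2_norm_eq_inner inner_diff_left inner_diff_right inner_commute
        power_mult_distrib algebra_simps)
  have nonneg: "0 \<le> (norm b)\<^sup>2 + (1 - A\<^sup>2) * (norm a)\<^sup>2"
    using A2 by simp
  have "((norm b)\<^sup>2 + (1 - A\<^sup>2) * (norm a)\<^sup>2)\<^sup>2 \<le> (2 * (a \<bullet> b))\<^sup>2"
    using base nonneg by (rule power_mono)
  moreover have "4 * ((1 - A\<^sup>2) * (norm a)\<^sup>2 * (norm b)\<^sup>2)
      \<le> ((norm b)\<^sup>2 + (1 - A\<^sup>2) * (norm a)\<^sup>2)\<^sup>2"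
    using zero_le_power2[of "(norm b)\<^sup>2 - (1 - A\<^sup>2) * (norm a)\<^sup>2"]
    by (simp add: power2_eq_square algebra_simps)
  ultimately show "(1 - A\<^sup>2) * (norm a)\<^sup>2 * (norm b)\<^sup>2 \<le> (a \<bullet> b)\<^sup>2"
    by (simp add: power_mult_distrib)
  have "norm b \<le> (1 + A) * norm a"
    using norm_triangle_ineq[of "b - a" a] close by (simp add: algebra_simps)
  then have "(norm b)\<^sup>2 \<le> ((1 + A) * norm a)\<^sup>2"
    by (simp add: power_mono)
  then have "(1 - A) * (norm b)\<^sup>2 \<le> (1 - A) * ((1 + A) * norm a)\<^sup>2"
    using A by (intro mult_left_mono) auto
  moreover have "(1 + A) * ((norm b)\<^sup>2 + (1 - A\<^sup>2) * (norm a)\<^sup>2) \<le> (1 + A) * (2 * (a \<bullet> b))"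
    using base A by (intro mult_left_mono) auto
  ultimately show "(norm b)\<^sup>2 \<le> (1 + A) * (a \<bullet> b)"
    by (simp add: power2_eq_square algebra_simps)
qed

definition polyak_update :: "(real ^ 'd \<Rightarrow> real ^ 'd) \<Rightarrow> real \<Rightarrow> real ^ 'd \<Rightarrow> real ^ 'd"
  where "polyak_update G g x = x - polyak_step G g x *\<^sub>R G (extrapolate G g x)"

lemma polyak_seg_Suc:
  "polyak_seg F B s g x0 (Suc k) =
    polyak_update (minibatch_op F B (s k)) (g k) (polyak_seg F B s g x0 k)"
  by (simp add: polyak_update_def Let_def)

lemma critical_condition_zero:
  assumes "A < 1" "critical_condition A G g x" "G (extrapolate G g x) = 0"
  shows "G x = 0"
proof -
  have "norm (G x) \<le> A * norm (G x)"
    using assms by (simp add: critical_condition_def)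
  then have "(1 - A) * norm (G x) \<le> 0"
    by (simp add: algebra_simps)
  then have "norm (G x) \<le> 0"
    using assms(1) by (simp add: mult_le_0_iff)
  then show ?thesis
    by simp
qed

text \<open>
  The update with Polyak step \<open>\<omega>\<close> projects \<open>x\<close> onto the hyperplane
  \<open>{u. G y \<bullet> (u - y) = 0}\<close> with \<open>y = extrapolate G g x\<close>.  Monotonicity puts \<open>z\<close> on the other side of
  that hyperplane, so the squared distance to \<open>z\<close> falls by at least the squared length
  \<open>\<omega>\<^sup>2 |G y|\<^sup>2\<close> of the projection step, that is, by \<open>g\<^sup>2\<close> times the square of the component of
  \<open>G x\<close> along \<open>G y\<close>.  Strong monotonicity puts \<open>z\<close> a definite distance beyond the hyperplane and adds
  \<open>2 \<omega> \<mu> |y - z|\<^sup>2\<close>.  Allowing \<open>\<mu> = 0\<close> covers the monotone case as well.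
\<close>
lemma polyak_update_descent:
  fixes G :: "real ^ 'd \<Rightarrow> real ^ 'd"
  assumes A: "0 \<le> A" "A < 1" and g: "0 < g" and mu: "0 \<le> \<mu>"
    and mono: "strongly_monotone_operator \<mu> G" and zero: "G z = 0"
    and crit: "critical_condition A G g x"
  shows "(norm (polyak_update G g x - z))\<^sup>2 + (1 - A\<^sup>2) * (g\<^sup>2 * (norm (G x))\<^sup>2)
      + 2 * (g * \<mu>) / (1 + A) * (norm (extrapolate G g x - z))\<^sup>2 \<le> (norm (x - z))\<^sup>2"
proof -
  define y where "y = extrapolate G g x"
  define a where "a = G x"
  define b where "b = G y"
  define w where "w = polyak_step G g x"
  have xy: "x - y = g *\<^sub>R a"
    by (simp add: y_def a_def extrapolate_def)
  have close: "norm (b - a) \<le> A * norm a"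
    using crit by (simp add: critical_condition_def a_def b_def y_def)
  have upd: "polyak_update G g x = x - w *\<^sub>R b"
    by (simp add: polyak_update_def w_def b_def y_def)
  have w: "w = g * (a \<bullet> b) / (norm b)\<^sup>2"
    using xy by (simp add: w_def polyak_step_def y_def b_def inner_commute)
  show ?thesis
  proof (cases "b = 0")
    case True
    \<comment> \<open>Here \<open>x\<close> is itself a zero of \<open>G\<close> and is not moved; if \<open>\<mu> > 0\<close>, it equals \<open>z\<close>.\<close>
    then have "a = 0"
      using critical_condition_zero[OF A(2) crit] by (simp add: a_def b_def y_def)
    moreover from this have "y = x"
      using xy by simp
    moreover have "\<mu> * (norm (x - z))\<^sup>2 \<le> 0"
      using mono[unfolded strongly_monotone_operator_def, rule_format, of x z] zero \<open>a = 0\<close>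
      by (simp add: a_def)
    moreover from this have "2 * (g * \<mu>) / (1 + A) * (norm (x - z))\<^sup>2 \<le> 0"
      using g A mult_nonneg_nonpos[of "2 * g / (1 + A)" "\<mu> * (norm (x - z))\<^sup>2"]
      by (simp add: mult.assoc)
    ultimately show ?thesis
      using upd True unfolding y_def[symmetric] a_def[symmetric] by simp
  next
    case False
    then have b: "0 < (norm b)\<^sup>2"
      by simp
    have low: "(norm b)\<^sup>2 \<le> (1 + A) * (a \<bullet> b)"
      by (rule relative_error_inner_lower[OF A close])
    then have ab: "1 / (1 + A) \<le> (a \<bullet> b) / (norm b)\<^sup>2"
      using b A by (simp add: field_simps)
    have wlow: "g / (1 + A) \<le> w"
      using mult_left_mono[OF ab, of g] g by (simp add: w)
    have wpos: "0 \<le> w"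
      using wlow g A by (meson divide_nonneg_nonneg add_nonneg_nonneg less_imp_le order_trans zero_le_one)
    have wb: "w * (norm b)\<^sup>2 = g * (a \<bullet> b)"
      using b by (simp add: w)
    have "(1 - A\<^sup>2) * (g\<^sup>2 * (norm a)\<^sup>2) * (norm b)\<^sup>2 \<le> g\<^sup>2 * (a \<bullet> b)\<^sup>2"
      using mult_left_mono[OF relative_error_inner_square[OF A close], of "g\<^sup>2"]
      by (simp add: algebra_simps)
    also have "\<dots> = (w * (norm b)\<^sup>2)\<^sup>2"
      by (simp add: wb power_mult_distrib)
    also have "\<dots> = w\<^sup>2 * (norm b)\<^sup>2 * (norm b)\<^sup>2"
      by (simp add: power2_eq_square)
    finally have gain: "(1 - A\<^sup>2) * (g\<^sup>2 * (norm a)\<^sup>2) \<le> w\<^sup>2 * (norm b)\<^sup>2"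
      using b by (meson mult_le_cancel_right_pos)
    have "\<mu> * (norm (y - z))\<^sup>2 \<le> b \<bullet> (y - z)"
      using mono[unfolded strongly_monotone_operator_def, rule_format, of y z] zero
      by (simp add: b_def)
    also have "b \<bullet> (y - z) = b \<bullet> (x - z) - b \<bullet> (x - y)"
      by (simp add: inner_diff_right)
    also have "b \<bullet> (x - y) = w * (norm b)\<^sup>2"
      by (simp add: xy wb inner_commute)
    finally have "w * (\<mu> * (norm (y - z))\<^sup>2) \<le> w * (b \<bullet> (x - z) - w * (norm b)\<^sup>2)"
      using wpos by (rule mult_left_mono)
    then have "w * (\<mu> * (norm (y - z))\<^sup>2) \<le> w * (b \<bullet> (x - z)) - w\<^sup>2 * (norm b)\<^sup>2"
      by (simp add: right_diff_distrib power2_eq_square)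
    moreover have "g / (1 + A) * (\<mu> * (norm (y - z))\<^sup>2) \<le> w * (\<mu> * (norm (y - z))\<^sup>2)"
      using wlow mu by (intro mult_right_mono) auto
    moreover have "(norm (x - w *\<^sub>R b - z))\<^sup>2
        = (norm (x - z))\<^sup>2 - 2 * (w * (b \<bullet> (x - z))) + w\<^sup>2 * (norm b)\<^sup>2"
    proof -
      have "x - w *\<^sub>R b - z = (x - z) - w *\<^sub>R b"
        by simp
      then show ?thesis
        by (simp only: power2_norm_eq_inner)
          (simp add: inner_diff_left inner_diff_right inner_commute power2_eq_square algebra_simps)
    qed
    ultimately have "(norm (x - w *\<^sub>R b - z))\<^sup>2 + w\<^sup>2 * (norm b)\<^sup>2
        + 2 * (g / (1 + A) * (\<mu> * (norm (y - z))\<^sup>2)) \<le> (norm (x - z))\<^sup>2"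
      by linarith
    then show ?thesis
      using gain unfolding upd y_def[symmetric] a_def[symmetric] by (simp add: mult.assoc)
  qed
qed

lemma strongly_monotone_imp_monotone:
  assumes "0 \<le> \<mu>" "strongly_monotone_operator \<mu> G"
  shows "strongly_monotone_operator 0 G"
  using assms unfolding strongly_monotone_operator_def
  by (metis mult_nonneg_nonneg mult_zero_left order_trans zero_le_power2)

lemma critical_constant_le:
  fixes A :: real
  assumes A: "0 \<le> A" "A < 1"
  shows "(1 - A) / (1 + A) \<le> 1 - A\<^sup>2"
proof -
  have "(1 - A) * 1 \<le> (1 - A) * ((1 + A) * (1 + A))"
    using A by (intro mult_left_mono) (auto simp: algebra_simps)
  then show ?thesis
    using A by (simp add: divide_simps power2_eq_square algebra_simps)
qed

lemma polyak_update_gain: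
  fixes G :: "real ^ 'd \<Rightarrow> real ^ 'd"
  assumes A: "0 \<le> A" "A < 1" and g: "0 < g"
    and mono: "strongly_monotone_operator 0 G" and zero: "G z = 0"
    and crit: "critical_condition A G g x"
  shows "(norm (polyak_update G g x - z))\<^sup>2 + (1 - A) / (1 + A) * (g\<^sup>2 * (norm (G x))\<^sup>2)
    \<le> (norm (x - z))\<^sup>2"
proof -
  have "(1 - A) / (1 + A) * (g\<^sup>2 * (norm (G x))\<^sup>2) \<le> (1 - A\<^sup>2) * (g\<^sup>2 * (norm (G x))\<^sup>2)"
    using critical_constant_le[OF A] by (intro mult_right_mono) auto
  with polyak_update_descent[OF A g order_refl mono zero crit] show ?thesis
    by simp
qed

lemma weighted_square_sum:
  fixes d e s :: real
  assumes "0 < s"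
  shows "(d + e)\<^sup>2 \<le> (1 + s) * d\<^sup>2 + (1 + 1 / s) * e\<^sup>2"
proof -
  have "0 \<le> (s * d - e)\<^sup>2 / s"
    using assms by simp
  also have "\<dots> = (1 + s) * d\<^sup>2 + (1 + 1 / s) * e\<^sup>2 - (d + e)\<^sup>2"
    using assms by (simp add: field_simps power2_eq_square)
  finally show ?thesis
    by simp
qed

text \<open>
  With \<open>d = |y - z|\<close> for the extrapolated point \<open>y\<close> and \<open>e = |x - y| = g |G x|\<close>, the descent
  inequality gains \<open>2 g \<mu> d\<^sup>2 / (1 + A) + (1 - A\<^sup>2) e\<^sup>2\<close>, and this must dominate a multiple of
  \<open>|x - z|\<^sup>2 \<le> (d + e)\<^sup>2\<close>.  That multiple is proportional to \<open>g \<mu>\<close>, and so is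
  the \<open>d\<^sup>2\<close> term of the gain; the \<open>e\<^sup>2\<close> term is not and can only absorb its share if \<open>g \<mu>\<close> is bounded.
  Strong monotonicity between \<open>x\<close> and \<open>y\<close> together with the critical condition provides
  \<open>g \<mu> \<le> A\<close> unless \<open>e = 0\<close>.
\<close>
lemma polyak_update_contraction:
  fixes G :: "real ^ 'd \<Rightarrow> real ^ 'd"
  assumes A: "0 < A" "A < 1" and g: "0 < g" and mu: "0 \<le> \<mu>"
    and mono: "strongly_monotone_operator \<mu> G" and zero: "G z = 0"
    and crit: "critical_condition A G g x"
  shows "(norm (polyak_update G g x - z))\<^sup>2
    \<le> (1 - 2 * (1 - A) * g * \<mu> / (1 + A)\<^sup>2) * (norm (x - z))\<^sup>2"
proof -
  define y where "y = extrapolate G g x"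
  define e where "e = norm (g *\<^sub>R G x)"
  define d where "d = norm (y - z)"
  define t where "t = g * \<mu>"
  have t0: "0 \<le> t"
    using g mu by (simp add: t_def)
  have xy: "x - y = g *\<^sub>R G x"
    by (simp add: y_def extrapolate_def)
  have e2: "e\<^sup>2 = g\<^sup>2 * (norm (G x))\<^sup>2"
    by (simp add: e_def power_mult_distrib)
  have te: "t * e\<^sup>2 \<le> A * e\<^sup>2"
  proof -
    have "\<mu> * e\<^sup>2 \<le> (G x - G y) \<bullet> (g *\<^sub>R G x)"
      using mono[unfolded strongly_monotone_operator_def, rule_format, of x y] xy
      by (simp add: e_def)
    also have "\<dots> \<le> norm (G x - G y) * (g * norm (G x))"
      using norm_cauchy_schwarz[of "G x - G y" "g *\<^sub>R G x"] g by simp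
    also have "\<dots> \<le> (A * norm (G x)) * (g * norm (G x))"
      using crit g
      by (intro mult_right_mono) (simp_all add: critical_condition_def y_def norm_minus_commute)
    finally have "g * (\<mu> * e\<^sup>2) \<le> g * ((A * norm (G x)) * (g * norm (G x)))"
      using g by (intro mult_left_mono) auto
    also have "\<dots> = A * e\<^sup>2"
      unfolding e2 by (simp add: power2_eq_square)
    finally show ?thesis
      by (simp add: t_def mult.assoc)
  qed
  have "norm (x - z) \<le> d + e"
    using norm_triangle_ineq[of "y - z" "x - y"] by (simp add: d_def e_def xy[symmetric])
  then have "(norm (x - z))\<^sup>2 \<le> (d + e)\<^sup>2"
    by (simp add: power_mono)
  \<comment> \<open>The weight makes the \<open>d\<^sup>2\<close> term below equal to the gain \<open>2 t d\<^sup>2 / (1 + A)\<close>; the \<open>e\<^sup>2\<close> term has slack.\<close>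
  also have "\<dots> \<le> (1 + 2 * A / (1 - A)) * d\<^sup>2 + (1 + 1 / (2 * A / (1 - A))) * e\<^sup>2"
    using A by (intro weighted_square_sum) simp
  also have "\<dots> = (1 + A) / (1 - A) * d\<^sup>2 + (1 + A) / (2 * A) * e\<^sup>2"
    using A by (simp add: field_simps)
  finally have "2 * (1 - A) * t / (1 + A)\<^sup>2 * (norm (x - z))\<^sup>2
      \<le> 2 * (1 - A) * t / (1 + A)\<^sup>2 * ((1 + A) / (1 - A) * d\<^sup>2 + (1 + A) / (2 * A) * e\<^sup>2)"
    using A t0 by (intro mult_left_mono) auto
  also have "\<dots> = 2 * t / (1 + A) * d\<^sup>2 + (1 - A) / (A * (1 + A)) * (t * e\<^sup>2)"
    using A by (simp add: divide_simps power2_eq_square) (simp add: algebra_simps)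
  also have "\<dots> \<le> 2 * t / (1 + A) * d\<^sup>2 + (1 - A) / (A * (1 + A)) * (A * e\<^sup>2)"
    using A te by (intro add_left_mono mult_left_mono) auto
  also have "(1 - A) / (A * (1 + A)) * (A * e\<^sup>2) = (1 - A) / (1 + A) * e\<^sup>2"
    using A by (simp add: divide_simps)
  also have "(1 - A) / (1 + A) * e\<^sup>2 \<le> (1 - A\<^sup>2) * e\<^sup>2"
    using critical_constant_le[of A] A by (intro mult_right_mono) auto
  finally have "2 * (1 - A) * t / (1 + A)\<^sup>2 * (norm (x - z))\<^sup>2
      \<le> 2 * t / (1 + A) * d\<^sup>2 + (1 - A\<^sup>2) * e\<^sup>2"
    by simp
  with polyak_update_descent[OF less_imp_le[OF A(1)] A(2) g mu mono zero crit] show ?thesis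
    by (simp add: e2 d_def t_def y_def algebra_simps)
qed

section \<open>Minibatch operators\<close>

lemma minibatch_op_zero:
  assumes "\<forall>i\<in>T. F i z = 0"
  shows "minibatch_op F B T z = 0"
  using assms by (simp add: minibatch_op_def)

lemma minibatch_op_strongly_monotone:
  fixes F :: "nat \<Rightarrow> real ^ 'd \<Rightarrow> real ^ 'd"
  assumes "card T = B" "1 \<le> B" "\<forall>i\<in>T. strongly_monotone_operator \<mu> (F i)"
  shows "strongly_monotone_operator \<mu> (minibatch_op F B T)"
  unfolding strongly_monotone_operator_def
proof (intro allI)
  fix x y :: "real ^ 'd"
  have "real B * (\<mu> * (norm (x - y))\<^sup>2) = (\<Sum>i\<in>T. \<mu> * (norm (x - y))\<^sup>2)"
    using assms(1) by simp
  also have "\<dots> \<le> (\<Sum>i\<in>T. (F i x - F i y) \<bullet> (x - y))"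
    using assms(3) by (intro sum_mono) (simp add: strongly_monotone_operator_def)
  also have "\<dots> = real B * ((minibatch_op F B T x - minibatch_op F B T y) \<bullet> (x - y))"
    using assms(2)
    by (simp add: minibatch_op_def scaleR_diff_right[symmetric] sum_subtractf[symmetric] inner_sum_left)
  finally show "\<mu> * (norm (x - y))\<^sup>2 \<le> (minibatch_op F B T x - minibatch_op F B T y) \<bullet> (x - y)"
    using assms(2) by simp
qed

section \<open>Measurability of the iterates\<close>

lemma minibatch_op_measurable:
  fixes F :: "nat \<Rightarrow> real ^ 'd \<Rightarrow> real ^ 'd"
  assumes s: "s \<in> measurable N (count_space UNIV)" and I: "finite I" "\<forall>w\<in>space N. s w \<subseteq> I"
    and F: "\<forall>i\<in>I. F i \<in> borel_measurable borel" and y: "y \<in> borel_measurable N"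
  shows "(\<lambda>w. minibatch_op F B (s w) (y w)) \<in> borel_measurable N"
proof -
  have "(\<lambda>w. (1 / real B) *\<^sub>R (\<Sum>i\<in>I. if i \<in> s w then F i (y w) else 0)) \<in> borel_measurable N"
  proof (intro borel_measurable_scaleR borel_measurable_const borel_measurable_sum measurable_If)
    fix i assume i: "i \<in> I"
    show "(\<lambda>w. F i (y w)) \<in> borel_measurable N"
      using F i by (intro measurable_compose[OF y]) auto
    have "Measurable.pred N (\<lambda>w. i \<in> s w)"
      by (rule measurable_compose[OF s]) simp
    then show "{w \<in> space N. i \<in> s w} \<in> sets N"
      by (simp add: pred_def)
  qed
  moreover have "minibatch_op F B (s w) (y w)
      = (1 / real B) *\<^sub>R (\<Sum>i\<in>I. if i \<in> s w then F i (y w) else 0)" if "w \<in> space N" for w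
    using I that by (auto simp: minibatch_op_def sum.inter_restrict[symmetric] Int_absorb1)
  ultimately show ?thesis
    by (subst measurable_cong) auto
qed

text \<open>
  The measure \<open>N\<close> is arbitrary so that the lemma applies both to the whole probability space and to the
  \<open>\<sigma>\<close>-algebra of the past.
\<close>
lemma polyak_seg_measurable:
  fixes F :: "nat \<Rightarrow> real ^ 'd \<Rightarrow> real ^ 'd"
  assumes s: "\<And>j. j < k \<Longrightarrow> s j \<in> measurable N (count_space UNIV)"
    and g: "\<And>j. j < k \<Longrightarrow> g j \<in> borel_measurable N"
    and I: "finite I" "\<forall>j. \<forall>w\<in>space N. s j w \<subseteq> I"
    and F: "\<forall>i\<in>I. F i \<in> borel_measurable borel"
  shows "(\<lambda>w. polyak_seg F B (\<lambda>j. s j w) (\<lambda>j. g j w) x0 k) \<in> borel_measurable N"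
  using s g
proof (induction k)
  case 0
  then show ?case by simp
next
  case (Suc k)
  define x where "x = (\<lambda>w. polyak_seg F B (\<lambda>j. s j w) (\<lambda>j. g j w) x0 k)"
  have [measurable]: "x \<in> borel_measurable N" "g k \<in> borel_measurable N"
    using Suc by (auto simp: x_def)
  have op: "(\<lambda>w. minibatch_op F B (s k w) (y w)) \<in> borel_measurable N"
    if "y \<in> borel_measurable N" for y
    using Suc I F that by (intro minibatch_op_measurable[where I = I]) auto
  define y where "y = (\<lambda>w. extrapolate (minibatch_op F B (s k w)) (g k w) (x w))"
  note [measurable] = op[OF \<open>x \<in> borel_measurable N\<close>]
  have [measurable]: "y \<in> borel_measurable N"
    unfolding y_def extrapolate_def by measurable
  note [measurable] = op[OF this]
  show ?case
    unfolding polyak_seg_Suc polyak_update_def polyak_step_def x_def[symmetric]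
    using \<open>x \<in> borel_measurable N\<close>
    by (simp only: x_def[symmetric, THEN fun_cong] y_def[symmetric, THEN fun_cong]) measurable
qed

section \<open>Independence of the minibatch from the past\<close>

text \<open>
  Both sides are integrals of \<open>h\<close> over \<open>N\<close>, the left one against \<open>H \<mapsto> prob (H \<inter> E)\<close> and the right one
  against \<open>H \<mapsto> prob H * prob E\<close>.  Independence says that these two measures on \<open>N\<close> agree.
\<close>
lemma (in prob_space) nn_integral_mult_indep_event:
  assumes sub: "subalgebra M N" and h: "h \<in> borel_measurable N"
    and E: "E \<in> events" and indep: "\<And>H. H \<in> sets N \<Longrightarrow> prob (H \<inter> E) = prob H * prob E"
  shows "(\<integral>\<^sup>+w. h w * indicator E w \<partial>M) = (\<integral>\<^sup>+w. h w \<partial>M) * emeasure M E"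
proof -
  define D where "D = density M (indicator E)"
  have hM: "h \<in> borel_measurable M"
    using measurable_from_subalg[OF sub h] .
  have subD: "subalgebra D N"
    using sub by (simp add: subalgebra_def D_def)
  have eq: "restr_to_subalg D N = scale_measure (emeasure M E) (restr_to_subalg M N)"
  proof (rule measure_eqI)
    fix H assume "H \<in> sets (restr_to_subalg D N)"
    then have H: "H \<in> sets N"
      by (simp add: sets_restr_to_subalg[OF subD])
    then have HM: "H \<in> events"
      using sub by (auto simp: subalgebra_def)
    have "emeasure D H = (\<integral>\<^sup>+w. indicator E w * indicator H w \<partial>M)"
      using HM E by (simp add: D_def emeasure_density)
    also have "\<dots> = (\<integral>\<^sup>+w. indicator (H \<inter> E) w \<partial>M)"
      by (intro nn_integral_cong) (auto simp: indicator_def)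
    also have "\<dots> = emeasure M (H \<inter> E)"
      using HM E by (intro nn_integral_indicator) auto
    also have "\<dots> = emeasure M E * emeasure M H"
      using indep[OF H] by (simp add: emeasure_eq_measure ennreal_mult mult.commute)
    finally show "emeasure (restr_to_subalg D N) H =
        emeasure (scale_measure (emeasure M E) (restr_to_subalg M N)) H"
      using H by (simp add: emeasure_restr_to_subalg[OF sub] emeasure_restr_to_subalg[OF subD])
  qed (simp add: sets_restr_to_subalg[OF sub] sets_restr_to_subalg[OF subD])
  have h': "h \<in> borel_measurable (restr_to_subalg M N)"
    using h by (simp add: measurable_def space_restr_to_subalg sets_restr_to_subalg[OF sub]
        sub[unfolded subalgebra_def, THEN conjunct1])
  have "(\<integral>\<^sup>+w. h w * indicator E w \<partial>M) = (\<integral>\<^sup>+w. h w \<partial>D)"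
    using hM E by (simp add: D_def nn_integral_density mult.commute)
  also have "\<dots> = (\<integral>\<^sup>+w. h w \<partial>restr_to_subalg D N)"
    by (rule nn_integral_subalgebra2[OF subD h, symmetric])
  also have "\<dots> = emeasure M E * (\<integral>\<^sup>+w. h w \<partial>restr_to_subalg M N)"
    unfolding eq using h' by (rule nn_integral_scale_measure)
  also have "(\<integral>\<^sup>+w. h w \<partial>restr_to_subalg M N) = (\<integral>\<^sup>+w. h w \<partial>M)"
    by (rule nn_integral_subalgebra2[OF sub h])
  finally show ?thesis
    by (simp add: mult.commute)
qed

text \<open>
  A variable \<open>s\<close> that is independent of \<open>N\<close> may be replaced by an independent copy in an expectation whose
  other ingredients are \<open>N\<close>-measurable.  As \<open>s\<close> takes finitely many values, the claim splits into the
  events \<open>s = T\<close>.  Nonnegative integrals spare integrability conditions on \<open>h T\<close>, which can fail for a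
  value \<open>T\<close> of probability zero.
\<close>
lemma (in prob_space) nn_integral_decouple:
  assumes sub: "subalgebra M N" and s: "s \<in> measurable M (count_space UNIV)"
    and ran: "finite R" "\<And>w. w \<in> space M \<Longrightarrow> s w \<in> R"
    and h: "\<And>T. T \<in> R \<Longrightarrow> h T \<in> borel_measurable N"
    and indep: "\<And>T H. H \<in> sets N \<Longrightarrow>
      prob (H \<inter> (s -` {T} \<inter> space M)) = prob H * prob (s -` {T} \<inter> space M)"
  shows "(\<integral>\<^sup>+w. (\<integral>\<^sup>+v. h (s v) w \<partial>M) \<partial>M) = (\<integral>\<^sup>+w. h (s w) w \<partial>M)"
proof -
  define E where "E T = s -` {T} \<inter> space M" for T
  have E [measurable]: "E T \<in> events" for T
    using measurable_sets[OF s, of "{T}"] by (simp add: E_def)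
  have hM [measurable]: "h T \<in> borel_measurable M" if "T \<in> R" for T
    using measurable_from_subalg[OF sub h[OF that]] .
  have split: "h (s v) w = (\<Sum>T\<in>R. h T w * indicator (E T) v)" if "v \<in> space M" for v w
  proof -
    have "(\<Sum>T\<in>R. h T w * indicator (E T) v) = (\<Sum>T\<in>R. if T = s v then h T w else 0)"
      using that by (intro sum.cong) (auto simp: E_def indicator_def)
    also have "\<dots> = h (s v) w"
      using ran that by (simp add: sum.delta)
    finally show ?thesis ..
  qed
  have "(\<integral>\<^sup>+w. (\<integral>\<^sup>+v. h (s v) w \<partial>M) \<partial>M)
      = (\<integral>\<^sup>+w. (\<integral>\<^sup>+v. (\<Sum>T\<in>R. h T w * indicator (E T) v) \<partial>M) \<partial>M)"
    by (intro nn_integral_cong) (simp add: split)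
  also have "\<dots> = (\<integral>\<^sup>+w. (\<Sum>T\<in>R. h T w * emeasure M (E T)) \<partial>M)"
    by (intro nn_integral_cong) (simp add: nn_integral_sum nn_integral_cmult_indicator)
  also have "\<dots> = (\<Sum>T\<in>R. \<integral>\<^sup>+w. h T w * emeasure M (E T) \<partial>M)"
    by (rule nn_integral_sum) simp
  also have "\<dots> = (\<Sum>T\<in>R. (\<integral>\<^sup>+w. h T w \<partial>M) * emeasure M (E T))"
    by (intro sum.cong) (simp_all add: nn_integral_multc)
  also have "\<dots> = (\<Sum>T\<in>R. \<integral>\<^sup>+w. h T w * indicator (E T) w \<partial>M)"
    using sub h indep
    by (intro sum.cong nn_integral_mult_indep_event[symmetric]) (auto simp: E_def[symmetric])
  also have "\<dots> = (\<integral>\<^sup>+w. (\<Sum>T\<in>R. h T w * indicator (E T) w) \<partial>M)"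
    by (rule nn_integral_sum[symmetric]) simp
  also have "\<dots> = (\<integral>\<^sup>+w. h (s w) w \<partial>M)"
    by (intro nn_integral_cong) (simp add: split)
  finally show ?thesis .
qed

lemma (in prob_space) norm_expectation_square_le:
  fixes f :: "'a \<Rightarrow> 'b :: {banach, second_countable_topology}"
  assumes f: "f \<in> borel_measurable M" and C: "\<And>w. w \<in> space M \<Longrightarrow> norm (f w) \<le> C"
  shows "(norm (expectation f))\<^sup>2 \<le> expectation (\<lambda>w. (norm (f w))\<^sup>2)"
proof -
  have int2: "integrable M (\<lambda>w. (norm (f w))\<^sup>2)"
    using f C by (intro integrable_const_bound[where B = "C\<^sup>2"]) (auto intro!: AE_I2 power_mono)
  have int: "integrable M (\<lambda>w. norm (f w))"
    using f C by (intro integrable_const_bound[where B = C]) (auto intro!: AE_I2)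
  have "(norm (expectation f))\<^sup>2 \<le> (expectation (\<lambda>w. norm (f w)))\<^sup>2"
    by (intro power_mono integral_norm_bound) simp
  also have "\<dots> \<le> expectation (\<lambda>w. (norm (f w))\<^sup>2)"
    using variance_eq[OF int int2] variance_positive[of "\<lambda>w. norm (f w)"] by simp
  finally show ?thesis .
qed

text \<open>
  Measurability with respect to the past refers to a measure, whereas \<open>history\<close> is a system of sets;
  this lemma is the bridge.
\<close>
lemma history_subalgebra:
  assumes "history M S \<gamma> k \<subseteq> sets M"
  obtains N where "subalgebra M N" "sets N = history M S \<gamma> k"
    "\<And>j. j < k \<Longrightarrow> S j \<in> measurable N (count_space UNIV)"
    "\<And>j. j \<le> k \<Longrightarrow> \<gamma> j \<in> borel_measurable N"
proof
  define \<G> where "\<G> = (\<Union>j\<in>{..<k}. sets (vimage_algebra (space M) (S j) (count_space UNIV))) \<union>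
     (\<Union>j\<in>{..k}. sets (vimage_algebra (space M) (\<gamma> j) borel))"
  let ?N = "sigma (space M) \<G>"
  have "\<G> \<subseteq> Pow (space M)"
    using sets.sets_into_space by (fastforce simp: \<G>_def)
  then show N: "sets ?N = history M S \<gamma> k"
    by (simp add: history_def \<G>_def sets_measure_of)
  have sp: "space ?N = space M"
    by (simp add: space_measure_of_conv)
  show "subalgebra M ?N"
    using assms N sp by (simp add: subalgebra_def)
  have gen: "X \<in> sets ?N" if "X \<in> \<G>" for X
    using that N by (auto simp: history_def \<G>_def)
  show "S j \<in> measurable ?N (count_space UNIV)" if "j < k" for j
  proof (rule measurableI)
    fix Y assume "Y \<in> sets (count_space (UNIV :: nat set set))"
    then have "S j -` Y \<inter> space M \<in> sets (vimage_algebra (space M) (S j) (count_space UNIV))"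
      by (rule in_vimage_algebra)
    then have "S j -` Y \<inter> space M \<in> \<G>"
      unfolding \<G>_def using that by (intro UnI1 UN_I[of j]) auto
    then show "S j -` Y \<inter> space ?N \<in> sets ?N"
      unfolding sp by (rule gen)
  qed simp
  show "\<gamma> j \<in> borel_measurable ?N" if "j \<le> k" for j
  proof (rule measurableI)
    fix Y :: "real set" assume "Y \<in> sets borel"
    then have "\<gamma> j -` Y \<inter> space M \<in> sets (vimage_algebra (space M) (\<gamma> j) borel)"
      by (rule in_vimage_algebra)
    then have "\<gamma> j -` Y \<inter> space M \<in> \<G>"
      unfolding \<G>_def using that by (intro UnI2 UN_I[of j]) auto
    then show "\<gamma> j -` Y \<inter> space ?N \<in> sets ?N"
      unfolding sp by (rule gen)
  qed simp
qed

section \<open>The convergence rates\<close>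

lemma Min_le_average:
  fixes f :: "nat \<Rightarrow> real"
  assumes "(\<Sum>k\<le>K. f k) \<le> C"
  shows "Min (f ` {0..K}) \<le> C / (real K + 1)"
proof -
  have "(real K + 1) * Min (f ` {0..K}) = (\<Sum>k\<le>K. Min (f ` {0..K}))"
    by simp
  also have "\<dots> \<le> (\<Sum>k\<le>K. f k)"
    by (intro sum_mono Min_le) auto
  finally show ?thesis
    using assms by (simp add: field_simps)
qed

theorem theorem3p3:
  fixes F :: "nat \<Rightarrow> real ^ 'd \<Rightarrow> real ^ 'd"
    and n B :: nat
    and L A :: real
    and x0 xs :: "real ^ 'd"
    and M :: "'w measure"
    and S :: "nat \<Rightarrow> 'w \<Rightarrow> nat set"
    and \<gamma> :: "nat \<Rightarrow> 'w \<Rightarrow> real"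
    and x :: "nat \<Rightarrow> 'w \<Rightarrow> real ^ 'd"
  assumes batch_size: "1 \<le> B" "B \<le> n"
    and lipschitz: "\<forall>i\<in>{1..n}. L-lipschitz_on UNIV (F i)"
    and interpolation: "\<forall>i\<in>{1..n}. F i xs = 0"
    and prob: "prob_space M"
    and batches: "\<forall>k. \<forall>w\<in>space M. S k w \<subseteq> {1..n} \<and> card (S k w) = B"
    and indep: "prob_space.indep_vars M (\<lambda>_. count_space UNIV) S UNIV"
    and unbiased: "\<forall>k y. (LINT w|M. minibatch_op F B (S k w) y) = full_op F n y"
    and step_meas: "\<forall>k. \<gamma> k \<in> borel_measurable M"
    and step_pos: "\<forall>k. \<forall>w\<in>space M. \<gamma> k w > 0"
    and iterates: "\<forall>k. \<forall>w\<in>space M.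
          x k w = polyak_seg F B (\<lambda>j. S j w) (\<lambda>j. \<gamma> j w) x0 k"
    and A: "0 < A" "A < 1"
    and critical: "\<forall>k. \<forall>w\<in>space M.
          critical_condition A (minibatch_op F B (S k w)) (\<gamma> k w) (x k w)"
  shows "((\<forall>i\<in>{1..n}. monotone_operator (F i)) \<and> sampled_after_step_size M S \<gamma> \<longrightarrow>
            (\<forall>K. (\<forall>k\<le>K. integrable M (\<lambda>w. (\<gamma> k w)\<^sup>2 * (norm (full_op F n (x k w)))\<^sup>2)) \<and>
                 Min ((\<lambda>k. LINT w|M. (\<gamma> k w)\<^sup>2 * (norm (full_op F n (x k w)))\<^sup>2) ` {0..K})
                   \<le> (1 + A) * (norm (x0 - xs))\<^sup>2 / ((1 - A) * (real K + 1)))) \<and>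
         (\<forall>\<mu>>0. (\<forall>i\<in>{1..n}. strongly_monotone_operator \<mu> (F i)) \<longrightarrow>
            (\<forall>k. integrable M (\<lambda>w. (norm (x (k + 1) w - xs))\<^sup>2) \<and>
                 integrable M (\<lambda>w. (1 - 2 * (1 - A) * \<gamma> k w * \<mu> / (1 + A)\<^sup>2) * (norm (x k w - xs))\<^sup>2) \<and>
                 (LINT w|M. (norm (x (k + 1) w - xs))\<^sup>2)
                   \<le> (LINT w|M. (1 - 2 * (1 - A) * \<gamma> k w * \<mu> / (1 + A)\<^sup>2) * (norm (x k w - xs))\<^sup>2)))"
proof -
  interpret prob_space M
    by (rule prob)
  define G where "G = (\<lambda>k w. minibatch_op F B (S k w))"
  define D where "D = (norm (x0 - xs))\<^sup>2"
  have F: "\<forall>i\<in>{1..n}. F i \<in> borel_measurable borel"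
    using lipschitz by (auto intro!: borel_measurable_continuous_onI lipschitz_on_continuous_on)
  have S [measurable]: "S k \<in> measurable M (count_space UNIV)" for k
    using indep by (auto simp: indep_vars_def)
  have [measurable]: "\<gamma> k \<in> borel_measurable M" for k
    using step_meas by simp
  have x_meas: "x k \<in> borel_measurable N"
    if "space N = space M" "\<And>j. j < k \<Longrightarrow> S j \<in> measurable N (count_space UNIV)"
      "\<And>j. j < k \<Longrightarrow> \<gamma> j \<in> borel_measurable N" for N k
  proof -
    have "(\<lambda>w. polyak_seg F B (\<lambda>j. S j w) (\<lambda>j. \<gamma> j w) x0 k) \<in> borel_measurable N"
      using that batches F by (intro polyak_seg_measurable[where I = "{1..n}"]) auto
    then show ?thesis
      using iterates that(1) by (subst measurable_cong) auto
  qed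
  have [measurable]: "x k \<in> borel_measurable M" for k
    by (rule x_meas) auto
  have x_Suc: "x (Suc k) w = polyak_update (G k w) (\<gamma> k w) (x k w)" if "w \<in> space M" for k w
    using iterates that by (simp add: polyak_seg_Suc G_def del: polyak_seg.simps)
  have zero: "G k w xs = 0" if "w \<in> space M" for k w
    unfolding G_def using batches interpolation that by (intro minibatch_op_zero) blast
  have mono: "strongly_monotone_operator \<mu> (G k w)"
    if "\<forall>i\<in>{1..n}. strongly_monotone_operator \<mu> (F i)" "w \<in> space M" for \<mu> k w
    unfolding G_def using batches batch_size that
    by (intro minibatch_op_strongly_monotone) blast+
  have crit: "critical_condition A (G k w) (\<gamma> k w) (x k w)" if "w \<in> space M" for k w
    using critical that by (simp add: G_def)
  have gain: "(norm (x (Suc k) w - xs))\<^sup>2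
      + (1 - A) / (1 + A) * ((\<gamma> k w)\<^sup>2 * (norm (G k w (x k w)))\<^sup>2) \<le> (norm (x k w - xs))\<^sup>2"
    if "\<forall>i\<in>{1..n}. strongly_monotone_operator 0 (F i)" "w \<in> space M" for k w
    using polyak_update_gain[OF _ A(2) _ mono[OF that] zero[OF that(2)] crit[OF that(2)]]
      A step_pos that(2) by (simp add: x_Suc)
  have bounded: "(norm (x k w - xs))\<^sup>2 \<le> D"
    if m: "\<forall>i\<in>{1..n}. strongly_monotone_operator 0 (F i)" and w: "w \<in> space M" for k w
  proof (induction k)
    case 0
    then show ?case using iterates w by (simp add: D_def)
  next
    case (Suc k)
    have "0 \<le> (1 - A) / (1 + A) * ((\<gamma> k w)\<^sup>2 * (norm (G k w (x k w)))\<^sup>2)"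
      using A by simp
    with gain[OF m w, of k] Suc show ?case
      by linarith
  qed
  have dist_int: "integrable M (\<lambda>w. (norm (x k w - xs))\<^sup>2)"
    if "\<forall>i\<in>{1..n}. strongly_monotone_operator 0 (F i)" for k
    using bounded[OF that] by (intro integrable_const_bound[where B = D] AE_I2) auto

  have sublinear: "(\<forall>k\<le>K. integrable M (\<lambda>w. (\<gamma> k w)\<^sup>2 * (norm (full_op F n (x k w)))\<^sup>2)) \<and>
      Min ((\<lambda>k. LINT w|M. (\<gamma> k w)\<^sup>2 * (norm (full_op F n (x k w)))\<^sup>2) ` {0..K})
        \<le> (1 + A) * (norm (x0 - xs))\<^sup>2 / ((1 - A) * (real K + 1))"
    if m': "\<forall>i\<in>{1..n}. monotone_operator (F i)" and smp: "sampled_after_step_size M S \<gamma>" for K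
  proof -
    have m: "\<forall>i\<in>{1..n}. strongly_monotone_operator 0 (F i)"
      using m' by (simp add: strongly_monotone_operator_def monotone_operator_def)
    define c where "c = (1 + A) / (1 - A)"
    have c: "0 < c" "c * ((1 - A) / (1 + A)) = 1"
      using A by (simp_all add: c_def)
    define q where "q = (\<lambda>k w. (\<gamma> k w)\<^sup>2 * (norm (G k w (x k w)))\<^sup>2)"
    define p where "p = (\<lambda>k w. (\<gamma> k w)\<^sup>2 * (norm (full_op F n (x k w)))\<^sup>2)"
    have q_le: "q k w \<le> c * ((norm (x k w - xs))\<^sup>2 - (norm (x (Suc k) w - xs))\<^sup>2)"
      if "w \<in> space M" for k w
    proof -
      have "c * ((1 - A) / (1 + A) * q k w)
          \<le> c * ((norm (x k w - xs))\<^sup>2 - (norm (x (Suc k) w - xs))\<^sup>2)"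
        using gain[OF m that, of k] c(1) by (intro mult_left_mono) (auto simp: q_def)
      moreover have "c * ((1 - A) / (1 + A) * q k w) = q k w"
        using c(2) by (metis mult.assoc mult_1)
      ultimately show ?thesis
        by simp
    qed
    have op_meas: "(\<lambda>w. G k w (y w)) \<in> borel_measurable M" if "y \<in> borel_measurable M" for k y
      unfolding G_def using that batches F
      by (intro minibatch_op_measurable[where I = "{1..n}"]) auto
    have [measurable]: "(\<lambda>w. G k w (x k w)) \<in> borel_measurable M" for k
      by (rule op_meas) simp
    have [measurable]: "full_op F n \<in> borel_measurable borel"
      unfolding full_op_def using F by (intro borel_measurable_scaleR borel_measurable_sum) auto
    have q_int: "integrable M (q k)" for k
    proof (rule Bochner_Integration.integrable_bound)
      show "integrable M (\<lambda>w. c * ((norm (x k w - xs))\<^sup>2 - (norm (x (Suc k) w - xs))\<^sup>2))"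
        using dist_int[OF m] by (intro integrable_mult_right Bochner_Integration.integrable_diff)
      show "q k \<in> borel_measurable M"
        unfolding q_def by measurable
      show "AE w in M. norm (q k w)
          \<le> norm (c * ((norm (x k w - xs))\<^sup>2 - (norm (x (Suc k) w - xs))\<^sup>2))"
        using q_le by (intro AE_I2) (auto simp: q_def intro: order_trans[OF _ abs_ge_self])
    qed
    have p_nn: "(\<integral>\<^sup>+w. ennreal (p k w) \<partial>M) \<le> ennreal (expectation (q k))" for k
    proof -
      let ?E = "sets (vimage_algebra (space M) (S k) (count_space UNIV))"
      have ind: "indep_set (history M S \<gamma> k) ?E"
        using smp by (simp add: sampled_after_step_size_def)
      then have "history M S \<gamma> k \<subseteq> sets M"
        by (simp add: indep_sets2_eq)
      then obtain N where N: "subalgebra M N" "sets N = history M S \<gamma> k"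
          "\<And>j. j < k \<Longrightarrow> S j \<in> measurable N (count_space UNIV)"
          "\<And>j. j \<le> k \<Longrightarrow> \<gamma> j \<in> borel_measurable N"
        by (rule history_subalgebra) blast
      have spN: "space N = space M"
        using N(1) by (simp add: subalgebra_def)
      have xN [measurable]: "x k \<in> borel_measurable N"
        using N by (intro x_meas spN) auto
      have gN [measurable]: "\<gamma> k \<in> borel_measurable N"
        using N by simp
      define h where "h = (\<lambda>T w. ennreal ((\<gamma> k w)\<^sup>2 * (norm (minibatch_op F B T (x k w)))\<^sup>2))"
      \<comment> \<open>For each outcome \<open>w\<close> of the past, average over a fresh draw \<open>v\<close> of the minibatch alone.\<close>
      have jensen: "ennreal (p k w) \<le> (\<integral>\<^sup>+v. h (S k v) w \<partial>M)" if w: "w \<in> space M" for w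
      proof -
        let ?f = "\<lambda>v. G k v (x k w)"
        define C where "C = Max ((\<lambda>T. norm (minibatch_op F B T (x k w))) ` Pow {1..n})"
        have C: "norm (?f v) \<le> C" if "v \<in> space M" for v
          unfolding C_def G_def using batches that by (intro Max_ge) auto
        have fm [measurable]: "?f \<in> borel_measurable M"
          by (rule op_meas) simp
        have int: "integrable M (\<lambda>v. (\<gamma> k w)\<^sup>2 * (norm (?f v))\<^sup>2)"
          using C by (intro integrable_mult_right integrable_const_bound[where B = "C\<^sup>2"])
            (auto intro!: AE_I2 power_mono)
        have "(norm (full_op F n (x k w)))\<^sup>2 \<le> expectation (\<lambda>v. (norm (?f v))\<^sup>2)"
          using norm_expectation_square_le[OF fm C] unbiased by (simp add: G_def)
        then have "p k w \<le> expectation (\<lambda>v. (\<gamma> k w)\<^sup>2 * (norm (?f v))\<^sup>2)"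
          by (simp add: p_def mult_left_mono)
        then show ?thesis
          using nn_integral_eq_integral[OF int] by (simp add: h_def G_def ennreal_leI)
      qed
      have "(\<integral>\<^sup>+w. ennreal (p k w) \<partial>M) \<le> (\<integral>\<^sup>+w. (\<integral>\<^sup>+v. h (S k v) w \<partial>M) \<partial>M)"
        using jensen by (intro nn_integral_mono) auto
      also have "\<dots> = (\<integral>\<^sup>+w. h (S k w) w \<partial>M)"
      proof (rule nn_integral_decouple[OF N(1) S, where R = "Pow {1..n}"])
        show "S k w \<in> Pow {1..n}" if "w \<in> space M" for w
          using batches that by blast
        show "h T \<in> borel_measurable N" if T: "T \<in> Pow {1..n}" for T
        proof -
          have "(\<lambda>w. minibatch_op F B T (x k w)) \<in> borel_measurable N"
            using T F by (intro minibatch_op_measurable[where I = "{1..n}"]) auto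
          then show ?thesis
            unfolding h_def by measurable
        qed
        show "prob (H \<inter> (S k -` {T} \<inter> space M)) = prob H * prob (S k -` {T} \<inter> space M)"
          if "H \<in> sets N" for T H
          using that by (intro indep_setD[OF ind]) (auto simp: N(2) intro!: in_vimage_algebra)
      qed simp
      also have "\<dots> = ennreal (expectation (q k))"
        using nn_integral_eq_integral[OF q_int[of k]] by (simp add: h_def q_def G_def)
      finally show ?thesis .
    qed
    have p_meas [measurable]: "p k \<in> borel_measurable M" for k
      unfolding p_def by measurable
    have p_int: "integrable M (p k)" for k
    proof (rule integrableI_bounded)
      show "(\<integral>\<^sup>+w. ennreal (norm (p k w)) \<partial>M) < \<infinity>"
        using le_less_trans[OF p_nn[of k], of \<infinity>] by (simp add: p_def)
    qed simp
    have p_le: "expectation (p k) \<le> expectation (q k)" for k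
    proof -
      have "0 \<le> expectation (q k)"
        by (simp add: q_def)
      then show ?thesis
        using p_nn[of k] nn_integral_eq_integral[OF p_int[of k]] by (simp add: p_def)
    qed
    have "(\<Sum>k\<le>K. expectation (p k)) \<le> (\<Sum>k\<le>K. expectation (q k))"
      by (intro sum_mono p_le)
    also have "\<dots> = expectation (\<lambda>w. \<Sum>k\<le>K. q k w)"
      using q_int by (simp add: Bochner_Integration.integral_sum)
    also have "\<dots> \<le> expectation (\<lambda>_. c * D)"
    proof (intro integral_mono Bochner_Integration.integrable_sum q_int integrable_const)
      fix w assume w: "w \<in> space M"
      have "(\<Sum>k\<le>K. q k w)
          \<le> (\<Sum>k\<le>K. c * ((norm (x k w - xs))\<^sup>2 - (norm (x (Suc k) w - xs))\<^sup>2))"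
        using q_le[OF w] by (intro sum_mono)
      also have "\<dots> = c * ((norm (x 0 w - xs))\<^sup>2 - (norm (x (Suc K) w - xs))\<^sup>2)"
        using sum_telescope[of "\<lambda>k. (norm (x k w - xs))\<^sup>2" K]
        by (simp add: sum_distrib_left[symmetric])
      also have "\<dots> \<le> c * D"
        using c(1) iterates w by (intro mult_left_mono) (auto simp: D_def)
      finally show "(\<Sum>k\<le>K. q k w) \<le> c * D" .
    qed
    also have "\<dots> = c * D"
      by (simp add: prob_space)
    finally have "Min ((\<lambda>k. expectation (p k)) ` {0..K}) \<le> c * D / (real K + 1)"
      by (rule Min_le_average)
    also have "\<dots> = (1 + A) * (norm (x0 - xs))\<^sup>2 / ((1 - A) * (real K + 1))"
      by (simp add: c_def D_def)
    finally show ?thesis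
      using p_int by (simp add: p_def)
  qed

  have linear: "integrable M (\<lambda>w. (norm (x (k + 1) w - xs))\<^sup>2) \<and>
      integrable M (\<lambda>w. (1 - 2 * (1 - A) * \<gamma> k w * \<mu> / (1 + A)\<^sup>2) * (norm (x k w - xs))\<^sup>2) \<and>
      (LINT w|M. (norm (x (k + 1) w - xs))\<^sup>2)
        \<le> (LINT w|M. (1 - 2 * (1 - A) * \<gamma> k w * \<mu> / (1 + A)\<^sup>2) * (norm (x k w - xs))\<^sup>2)"
    if mu: "\<mu> > 0" and ms: "\<forall>i\<in>{1..n}. strongly_monotone_operator \<mu> (F i)" for \<mu> k
  proof -
    let ?r = "\<lambda>w. (1 - 2 * (1 - A) * \<gamma> k w * \<mu> / (1 + A)\<^sup>2) * (norm (x k w - xs))\<^sup>2"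
    have m: "\<forall>i\<in>{1..n}. strongly_monotone_operator 0 (F i)"
      using ms mu strongly_monotone_imp_monotone[of \<mu>] by auto
    have le: "(norm (x (k + 1) w - xs))\<^sup>2 \<le> ?r w" if w: "w \<in> space M" for w
      using polyak_update_contraction[OF A _ less_imp_le[OF mu] mono[OF ms w] zero[OF w] crit[OF w]]
        step_pos w by (simp add: x_Suc)
    have r_bound: "norm (?r w) \<le> D" if w: "w \<in> space M" for w
    proof -
      \<comment> \<open>The step sizes may be unbounded, but the contraction itself makes the factor nonnegative
        wherever the distance is nonzero.\<close>
      have "0 \<le> 2 * (1 - A) * \<gamma> k w * \<mu> / (1 + A)\<^sup>2"
        using A mu step_pos w by (intro divide_nonneg_nonneg mult_nonneg_nonneg) (auto intro: less_imp_le)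
      then have "?r w \<le> 1 * (norm (x k w - xs))\<^sup>2"
        by (intro mult_right_mono) auto
      moreover have "0 \<le> ?r w"
        using le[OF w] by (rule order_trans[rotated]) simp
      ultimately show ?thesis
        using bounded[OF m w, of k] by simp
    qed
    have r_int: "integrable M ?r"
      using r_bound by (intro integrable_const_bound[where B = D] AE_I2) auto
    show ?thesis
      using dist_int[OF m, of "k + 1"] r_int le by (auto intro!: integral_mono)
  qed
  show ?thesis
    using sublinear linear by blast
qed

end
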